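(* Let $M$ be a complete, separable metric space and let $\nu$ be a non-atomic Borel probability measure on $M$. If $f : M \to M$ is a $\nu$-preserving isometry, then the dynamical system $(M, \nu, \mathbb{N}, f)$ does not have the shrinking target property (STP).
   Context: $B(x,\rho)$ is the open ball in $M$ ($B(x,0)=\emptyset$). $\mathbb{N}$ is the usual additive semigroup, acting by the iterates $f^n$. A system $(M,\nu,\mathbb{N},f)$, with $M$ a metric space, $\nu$ a finite Borel measure on $M$ and $f : M \to M$ a $\nu$-preserving map, has STP if for every $x \in M$ and every radius sequence $r : \mathbb{N} \to \mathbb{R}_{\geq 0}$ (no monotonicity required), with $r_n := r(n)$, such that $\sum_{n \in \mathbb{N}} \nu(B(x, r_n)) = \infty$, one has $\nu(\limsup_n f^{-n}B(x, r_n)) = \nu(M)$, where $f^{-n}B(x,r_n)$ is the preimage under $f^n$ and $\limsup_n f^{-n}B(x,r_n)$ is the set of points lying in $f^{-n}B(x,r_n)$ for infinitely many $n$. *)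

theory Defs
  imports "HOL-Probability.Probability"
begin

text \<open>A measure is non-atomic if it has no atoms in the measure-theoretic sense: an atom is a
  measurable set of positive measure none of whose measurable subsets has strictly smaller
  positive measure.\<close>

definition measure_atom :: "'a measure \<Rightarrow> 'a set \<Rightarrow> bool" where
  "measure_atom N A \<longleftrightarrow> A \<in> sets N \<and> 0 < emeasure N A \<and>
     (\<forall>B\<in>sets N. B \<subseteq> A \<and> emeasure N B < emeasure N A \<longrightarrow> emeasure N B = 0)"

definition nonatomic_measure :: "'a measure \<Rightarrow> bool" where
  "nonatomic_measure N \<longleftrightarrow> (\<nexists>A. measure_atom N A)"

definition preserves_measure :: "'a measure \<Rightarrow> ('a \<Rightarrow> 'a) \<Rightarrow> bool" where
  "preserves_measure N f \<longleftrightarrow> f \<in> measurable N N \<and>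
     (\<forall>A\<in>sets N. emeasure N (f -` A \<inter> space N) = emeasure N A)"

text \<open>Distance preserving; surjectivity is not required.\<close>

definition metric_isometry :: "('a::metric_space \<Rightarrow> 'b::metric_space) \<Rightarrow> bool" where
  "metric_isometry f \<longleftrightarrow> (\<forall>x y. dist (f x) (f y) = dist x y)"

text \<open>The shrinking target property of the action of the natural numbers by the iterates of
  \<open>f\<close>. It is meant for a finite Borel measure preserved by \<open>f\<close>, which makes every set below
  measurable. \<open>limsup\<close> is the limit superior in the complete lattice of sets, i.e. the set of
  points lying in infinitely many members of the sequence. The sum is taken in \<open>[0,\<infinity>]\<close>.\<close>

definition has_STP :: "'a::metric_space measure \<Rightarrow> ('a \<Rightarrow> 'a) \<Rightarrow> bool" where
  "has_STP N f \<longleftrightarrow>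
     (\<forall>(x::'a) (r::nat \<Rightarrow> real).
        (\<forall>n. 0 \<le> r n) \<longrightarrow> (\<Sum>n. emeasure N (ball x (r n))) = \<infinity> \<longrightarrow>
        emeasure N (limsup (\<lambda>n. (f ^^ n) -` ball x (r n))) = emeasure N (space N))"

end

theory Submission
  imports Defs
begin

text \<open>A point \<open>x\<close> of the support of \<open>\<nu>\<close> returns to each of its neighbourhoods infinitely often,
  by the pigeonhole argument of Poincare recurrence. Take \<open>\<rho> k \<rightarrow> 0\<close> so slowly that
  \<open>\<Sum>k. \<nu> (ball x (\<rho> k))\<close> diverges, and return times \<open>N 0 < N 1 < \<dots>\<close> with
  \<open>dist ((f ^^ N k) x) x < \<rho> k\<close>. Use the radius \<open>\<rho> k\<close> at time \<open>N k\<close>, and the radius \<open>0\<close> at all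
  other times. As \<open>f\<close> is an isometry, a point hitting the target at time \<open>N k\<close> is within \<open>2 * \<rho> k\<close>
  of \<open>x\<close>; so only \<open>x\<close> itself can hit infinitely often, and \<open>{x}\<close> is a null set.\<close>

lemma metric_isometry_funpow:
  fixes f :: "'a::metric_space \<Rightarrow> 'a"
  shows "metric_isometry f \<Longrightarrow> metric_isometry (f ^^ n)"
  by (induction n) (auto simp: metric_isometry_def)

lemma preserves_measure_funpow:
  assumes "preserves_measure M f"
  shows "preserves_measure M (f ^^ n)"
proof (induction n)
  case 0
  then show ?case
    by (auto simp: preserves_measure_def dest: sets.sets_into_space
        intro!: arg_cong[where f = "emeasure M"])
next
  case (Suc n)
  have f: "f \<in> measurable M M" and fn: "f ^^ n \<in> measurable M M"
    using assms Suc by (auto simp: preserves_measure_def)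
  have "emeasure M ((f ^^ Suc n) -` A \<inter> space M) = emeasure M A" if A: "A \<in> sets M" for A
  proof -
    have "(f ^^ Suc n) -` A \<inter> space M = (f ^^ n) -` (f -` A \<inter> space M) \<inter> space M"
      using measurable_space[OF fn] by auto
    moreover have "emeasure M ((f ^^ n) -` (f -` A \<inter> space M) \<inter> space M) = emeasure M (f -` A \<inter> space M)"
      using Suc measurable_sets[OF f A] unfolding preserves_measure_def by blast
    ultimately show ?thesis
      using assms A unfolding preserves_measure_def by metis
  qed
  then show ?case
    using measurable_comp[OF fn f] unfolding preserves_measure_def funpow.simps by blast
qed

text \<open>The only proper subset of a singleton is empty, so a singleton of positive measure would
  be an atom. Its measurability comes from positivity, since \<open>emeasure\<close> is 0 outside
  \<open>sets M\<close>.\<close>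

lemma nonatomic_emeasure_singleton:
  assumes "nonatomic_measure M"
  shows "emeasure M {x} = 0"
proof (rule ccontr)
  assume pos: "emeasure M {x} \<noteq> 0"
  then have "{x} \<in> sets M"
    using emeasure_notin_sets by blast
  moreover have "emeasure M B = 0" if "B \<subseteq> {x}" "emeasure M B < emeasure M {x}" for B
    using that by (auto simp: subset_singleton_iff)
  ultimately have "measure_atom M {x}"
    using pos by (auto simp: measure_atom_def zero_less_iff_neq_zero)
  then show False
    using assms by (auto simp: nonatomic_measure_def)
qed

text \<open>Otherwise every point has a null ball around it, and by Lindelof countably many of these
  cover the space, which would then be null.\<close>

lemma exists_support_point:
  fixes M :: "'a::{metric_space, second_countable_topology} measure"
  assumes sets: "sets M = sets borel" and nz: "emeasure M (space M) \<noteq> 0"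
  obtains x where "\<And>e. e > 0 \<Longrightarrow> emeasure M (ball x e) > 0"
proof (rule ccontr)
  assume "\<not> thesis"
  then have "\<exists>e>0. emeasure M (ball x e) = 0" for x
    using that by (metis zero_less_iff_neq_zero)
  then obtain e where e: "\<And>x. e x > 0" "\<And>x. emeasure M (ball x (e x)) = 0"
    by metis
  obtain \<F> where \<F>: "\<F> \<subseteq> range (\<lambda>x. ball x (e x))" "countable \<F>"
      "\<Union>\<F> = (\<Union>x. ball x (e x))"
    using Lindelof[of "range (\<lambda>x. ball x (e x))"] by auto
  have "ball x (e x) \<in> null_sets M" for x
    by (intro null_setsI) (simp_all add: e(2) sets)
  then have "(\<Union>B\<in>\<F>. B) \<in> null_sets M"
    using \<F>(1,2) by (intro null_sets_UN') blast+
  moreover have "x \<in> (\<Union>x. ball x (e x))" for x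
    using e(1)[of x] by (intro UN_I[of x]) auto
  then have "(\<Union>B\<in>\<F>. B) = space M"
    using \<F>(3) sets_eq_imp_space_eq[OF sets] by (simp add: set_eq_iff)
  ultimately show False
    using nz by auto
qed

text \<open>Recurrence yields some point \<open>z\<close> near \<open>x\<close> that returns near
  \<open>x\<close>; the isometry carries this return over to \<open>x\<close> itself, at the cost of
  doubling the radius.\<close>

lemma isometry_infinitely_recurrent:
  fixes M :: "'a::metric_space measure"
  assumes fin: "finite_measure M" and sets: "sets M = sets borel"
    and pres: "preserves_measure M f" and iso: "metric_isometry f"
    and pos: "\<And>e. e > 0 \<Longrightarrow> emeasure M (ball x e) > 0" and e: "e > 0"
  shows "\<exists>n>m. dist ((f ^^ n) x) x < e"
proof -
  interpret finite_measure M by (rule fin)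
  have sp: "space M = UNIV"
    using sets_eq_imp_space_eq[OF sets] by simp
  define B where "B = ball x (e / 2)"
  have B: "B \<in> sets M" by (simp add: B_def sets)
  \<comment> \<open>Only multiples of \<open>Suc m\<close> are used as times, so that any two
    distinct times differ by more than \<open>m\<close>.\<close>
  define A where "A i = (f ^^ (Suc m * i)) -` B" for i
  have A: "A i \<in> sets M" "emeasure M (A i) = emeasure M B" for i
    using preserves_measure_funpow[OF pres, of "Suc m * i"] B measurable_sets[of "f ^^ (Suc m * i)" M M B]
    by (auto simp: preserves_measure_def A_def sp simp del: mult_Suc)
  have "\<not> disjoint_family A"
  proof
    \<comment> \<open>In a finite measure space disjoint sets have summable measures, but here all
      of them equal the measure of \<open>B\<close>.\<close>
    assume "disjoint_family A"
    then have "summable (\<lambda>i. measure M (A i))"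
      using A finite_measure_UNION[of A] by (auto simp: sums_iff)
    then have "measure M B = 0"
      using A(2) by (simp add: measure_def summable_const_iff)
    then show False
      using pos[of "e / 2"] e by (simp add: B_def emeasure_eq_measure)
  qed
  then obtain i j where ij: "i < j" "A i \<inter> A j \<noteq> {}"
    unfolding disjoint_family_on_def by (metis Int_commute linorder_neqE_nat)
  then obtain y where y: "y \<in> A i" "y \<in> A j"
    by blast
  define n where "n = Suc m * (j - i)"
  define z where "z = (f ^^ (Suc m * i)) y"
  have "Suc m * j = n + Suc m * i"
    using ij(1) by (simp add: n_def diff_mult_distrib2 del: mult_Suc)
  then have "(f ^^ n) z = (f ^^ (Suc m * j)) y"
    by (simp add: z_def funpow_add del: mult_Suc)
  then have z: "dist x z < e / 2" "dist x ((f ^^ n) z) < e / 2"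
    using y by (auto simp: A_def B_def z_def simp del: mult_Suc)
  have "dist ((f ^^ n) x) ((f ^^ n) z) = dist x z"
    using metric_isometry_funpow[OF iso] by (simp add: metric_isometry_def)
  then have "dist ((f ^^ n) x) x < e"
    using z dist_triangle2[of "(f ^^ n) x" x "(f ^^ n) z"] by linarith
  moreover have "n > m"
    using ij(1) by (cases "j - i") (auto simp: n_def)
  ultimately show ?thesis by blast
qed

text \<open>Let \<open>h k\<close> be the largest \<open>j \<le> k\<close> with
  \<open>g j \<ge> 1/k\<close>. Each fixed \<open>j\<close> is eventually admissible, so
  \<open>h\<close> tends to infinity, while \<open>g (h k)\<close> dominates the harmonic
  series.\<close>

lemma slow_reindexing_not_summable:
  fixes g :: "nat \<Rightarrow> real"
  assumes pos: "\<And>j. g j > 0"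
  obtains h where "filterlim h at_top sequentially" "\<not> summable (\<lambda>k. g (h k))"
proof -
  \<comment> \<open>The bound \<open>j \<le> k\<close> makes \<open>S k\<close> finite, so
    \<open>Max\<close> is meaningful once \<open>S k\<close> is nonempty, which holds for all large
    \<open>k\<close>.\<close>
  define S where "S k = {j. j \<le> k \<and> inverse (real k) \<le> g j}" for k
  define h where "h k = Max (S k)" for k
  have ev: "eventually (\<lambda>k. j \<in> S k) sequentially" for j
  proof -
    have "eventually (\<lambda>k. inverse (real k) < g j) sequentially"
      using order_tendstoD(2)[OF tendsto_inverse_0_at_top[OF filterlim_real_sequentially] pos] .
    then show ?thesis
      using eventually_ge_at_top[of j] by eventually_elim (auto simp: S_def)
  qed
  have fin: "finite (S k)" for k
    by (rule finite_subset[of _ "{..k}"]) (auto simp: S_def)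
  have "filterlim h at_top sequentially"
    unfolding filterlim_at_top
  proof
    fix j show "eventually (\<lambda>k. j \<le> h k) sequentially"
      using ev[of j] by eventually_elim (use fin in \<open>auto simp: h_def\<close>)
  qed
  moreover have "eventually (\<lambda>k. norm (inverse (real k)) \<le> g (h k)) sequentially"
    using ev[of 0]
  proof eventually_elim
    case (elim k)
    then have "h k \<in> S k"
      using Max_in[OF fin] by (auto simp: h_def)
    then show ?case by (simp add: S_def)
  qed
  then have "\<not> summable (\<lambda>k. g (h k))"
    using summable_comparison_test_ev[of "\<lambda>k. inverse (real k)" "\<lambda>k. g (h k)"]
      not_summable_harmonic[where ?'a = real] by argo
  ultimately show thesis by (rule that)
qed

theorem theorem1p8:
  fixes \<nu> :: "'a::polish_space measure" and f :: "'a \<Rightarrow> 'a"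
  assumes "sets \<nu> = sets borel" and "prob_space \<nu>" and "nonatomic_measure \<nu>"
    and "preserves_measure \<nu> f" and "metric_isometry f"
  shows "\<not> has_STP \<nu> f"
proof
  assume STP: "has_STP \<nu> f"
  interpret prob_space \<nu> by fact
  obtain x where supp: "\<And>e. e > 0 \<Longrightarrow> emeasure \<nu> (ball x e) > 0"
    using exists_support_point[OF assms(1)] emeasure_space_1 by auto
  define \<delta> where "\<delta> j = inverse (real (Suc j))" for j
  have \<delta>: "\<delta> j > 0" for j
    by (simp add: \<delta>_def)
  obtain h where h: "filterlim h at_top sequentially"
      "\<not> summable (\<lambda>k. measure \<nu> (ball x (\<delta> (h k))))"
    using slow_reindexing_not_summable[of "\<lambda>j. measure \<nu> (ball x (\<delta> j))"] supp[OF \<delta>]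
    by (auto simp: emeasure_eq_measure)
  define \<rho> where "\<rho> k = \<delta> (h k)" for k
  have \<rho>_lim: "\<rho> \<longlonglongrightarrow> 0"
    unfolding \<rho>_def using filterlim_compose[OF LIMSEQ_inverse_real_of_nat h(1)]
    by (simp add: \<delta>_def)
  have \<rho>_pos: "\<rho> k > 0" for k
    by (simp add: \<rho>_def \<delta>)
  have \<rho>_sum: "(\<Sum>k. emeasure \<nu> (ball x (\<rho> k))) = \<infinity>"
    unfolding emeasure_eq_measure
    using h(2) summable_suminf_not_top[of "\<lambda>k. measure \<nu> (ball x (\<rho> k))"]
    unfolding \<rho>_def infinity_ennreal_def by (metis measure_nonneg)
  have rec: "\<exists>n>m. dist ((f ^^ n) x) x < \<rho> k" for m k
    using isometry_infinitely_recurrent[OF finite_measure_axioms assms(1,4,5) supp \<rho>_pos] .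
  have "\<exists>N. \<forall>k. dist ((f ^^ N k) x) x < \<rho> k \<and> N k < N (Suc k)"
    by (rule dependent_nat_choice) (use rec in blast)+
  then obtain N where N: "\<And>k. dist ((f ^^ N k) x) x < \<rho> k" "\<And>k. N k < N (Suc k)"
    by blast
  have mono: "strict_mono N"
    using N(2) by (simp add: strict_mono_Suc_iff)
  then have inj: "inj N"
    by (rule strict_mono_imp_inj_on)
  \<comment> \<open>The ball of radius 0 is empty, so times outside the range of \<open>N\<close>
    add nothing to the sum and are never hits.\<close>
  define r where "r n = (if n \<in> range N then \<rho> (inv N n) else 0)" for n
  have r_N: "r (N k) = \<rho> k" for k
    using inj by (simp add: r_def)
  have "(\<Sum>n. emeasure \<nu> (ball x (r n))) = (\<Sum>k. emeasure \<nu> (ball x (r (N k))))"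
    using mono by (intro suminf_mono_reindex[symmetric]) (auto simp: r_def)
  then have "(\<Sum>n. emeasure \<nu> (ball x (r n))) = \<infinity>"
    using \<rho>_sum by (simp add: r_N)
  moreover have "0 \<le> r n" for n
    using \<rho>_pos by (simp add: r_def less_imp_le)
  ultimately have full:
    "emeasure \<nu> (limsup (\<lambda>n. (f ^^ n) -` ball x (r n))) = emeasure \<nu> (space \<nu>)"
    using STP by (auto simp: has_STP_def)
  have "limsup (\<lambda>n. (f ^^ n) -` ball x (r n)) \<subseteq> {x}"
  proof
    fix y assume "y \<in> limsup (\<lambda>n. (f ^^ n) -` ball x (r n))"
    then have y: "\<exists>n\<ge>m. y \<in> (f ^^ n) -` ball x (r n)" for m
      unfolding mem_limsup_iff frequently_sequentially by blast
    have "dist y x \<le> e" if "e > 0" for e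
    proof -
      \<comment> \<open>From index \<open>K\<close> on, both the target radius and the distance from
        \<open>x\<close> to its return are below \<open>e / 2\<close>.\<close>
      obtain K where K: "\<And>k. k \<ge> K \<Longrightarrow> \<rho> k < e / 2"
        using order_tendstoD(2)[OF \<rho>_lim, of "e / 2"] \<open>e > 0\<close>
        by (auto simp: eventually_sequentially)
      obtain n where n: "n \<ge> N K" "dist x ((f ^^ n) y) < r n"
        using y[of "N K"] by auto
      \<comment> \<open>A hit forces \<open>r n > 0\<close>, hence \<open>n\<close> is one of the
        chosen return times.\<close>
      then obtain k where k: "n = N k"
        using zero_le_dist[of x "(f ^^ n) y"] by (auto simp: r_def split: if_splits)
      then have "k \<ge> K"
        using n(1) mono by (simp add: strict_mono_less_eq)
      have "dist y x = dist ((f ^^ n) y) ((f ^^ n) x)"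
        using metric_isometry_funpow[OF assms(5)] by (simp add: metric_isometry_def)
      also have "\<dots> \<le> dist x ((f ^^ n) y) + dist ((f ^^ n) x) x"
        by (metis dist_commute dist_triangle)
      also have "\<dots> \<le> e"
        using n(2) N(1)[of k] K[OF \<open>k \<ge> K\<close>] by (simp add: k r_N)
      finally show ?thesis .
    qed
    then have "dist y x \<le> 0"
      by (rule field_le_epsilon[of _ 0, simplified])
    then show "y \<in> {x}" by simp
  qed
  then have "emeasure \<nu> (limsup (\<lambda>n. (f ^^ n) -` ball x (r n))) \<le> emeasure \<nu> {x}"
    by (rule emeasure_mono) (simp add: assms(1))
  then show False
    using full emeasure_space_1 nonatomic_emeasure_singleton[OF assms(3)] by simp
qed

end
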